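(* Let $\{Y_v\}_{v\in V}$ be real-valued random variables having a dependency graph $G=(V,E)$. Then, for every $b$-fold coloring of $G$ using $\chi_b:=\chi_b(G)$ colors, we have \[ \mathbb{E}\left[\prod_{v\in V} Y_{v} \right] \leq \prod_{v\in V} \left\{ \mathbb{E}\left[Y_{v}^{\frac{\chi_b}{b}}\right] \right\}^{\frac{b}{\chi_b}}. \]
   Context: Dependency graph: a dependency graph for random variables $\{Y_v\}_{v\in V}$ indexed by a finite set $V$ is any loopless graph $G=(V,E)$ whose vertex set $V$ is the index set of the random variables and whose edge set is such that, if $V'\subseteq V$ and $v\in V\setminus V'$ is not adjacent to any vertex of $V'$, then $Y_v$ is mutually independent of the random variables $Y_{v'}$ with $v'\in V'$. $b$-fold chromatic number: for a positive integer $b$, a $b$-fold coloring of $G$ is an assignment of sets (of colors) of size $b$ to the vertices of $G$ such that adjacent vertices have disjoint sets. $G$ is $(a:b)$-colorable if it has a $b$-fold coloring using $a$ different colors. The $b$-fold chromatic number $\chi_b(G)$ is the least $a$ for which $G$ is $(a:b)$-colorable. $\mathbb{E}$ denotes expectation.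
   Formalization: For signed variables the claim can fail (K_3, b=1, two equal fair signs and the constant 1), so it is proved for Y_v ≥ 0 a.s., for integrable |Y_v|^{χ_b/b} with |Y_v| in place of Y_v on the right, and verbatim for signed integrable Y_v when χ_b = b. *)

theory Defs
  imports "HOL-Probability.Probability"
begin

text \<open>Edges are two-element vertex sets; parallel edges would play no role below.\<close>

definition finite_loopless_graph :: "'v set \<Rightarrow> 'v set set \<Rightarrow> bool" where
  "finite_loopless_graph V E \<longleftrightarrow> finite V \<and> (\<forall>e\<in>E. e \<subseteq> V \<and> card e = 2)"

text \<open>``\<open>Y v\<close> is mutually independent of the \<open>Y u\<close> with \<open>u \<in> U\<close>'' means that \<open>Y v\<close> is
  independent of the whole random vector \<open>(Y u)\<close> with \<open>u\<close> ranging over \<open>U\<close>, that is, of the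
  sigma-algebra these variables generate jointly. Since \<open>indep_var\<close> wants both variables to have
  the same value type, \<open>Y v\<close> enters as a random vector with the single coordinate \<open>v\<close>.\<close>

definition dependency_graph ::
    "'w measure \<Rightarrow> ('v \<Rightarrow> 'w \<Rightarrow> real) \<Rightarrow> 'v set \<Rightarrow> 'v set set \<Rightarrow> bool" where
  "dependency_graph M Y V E \<longleftrightarrow>
     finite_loopless_graph V E \<and>
     (\<forall>v\<in>V. Y v \<in> borel_measurable M) \<and>
     (\<forall>U v. U \<subseteq> V \<and> v \<in> V - U \<and> (\<forall>u\<in>U. {v, u} \<notin> E) \<longrightarrow>
        prob_space.indep_var M
          (\<Pi>\<^sub>M u\<in>{v}. borel) (\<lambda>\<omega>. \<lambda>u\<in>{v}. Y u \<omega>)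
          (\<Pi>\<^sub>M u\<in>U. borel) (\<lambda>\<omega>. \<lambda>u\<in>U. Y u \<omega>))"

definition fold_coloring ::
    "'v set \<Rightarrow> 'v set set \<Rightarrow> nat \<Rightarrow> ('v \<Rightarrow> 'c set) \<Rightarrow> bool" where
  "fold_coloring V E b c \<longleftrightarrow>
     (\<forall>v\<in>V. finite (c v) \<and> card (c v) = b) \<and>
     (\<forall>u\<in>V. \<forall>v\<in>V. {u, v} \<in> E \<longrightarrow> c u \<inter> c v = {})"

definition colors_used :: "'v set \<Rightarrow> ('v \<Rightarrow> 'c set) \<Rightarrow> nat" where
  "colors_used V c = card (\<Union>v\<in>V. c v)"

definition fold_colorable :: "'v set \<Rightarrow> 'v set set \<Rightarrow> nat \<Rightarrow> nat \<Rightarrow> bool" where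
  "fold_colorable V E a b \<longleftrightarrow>
     (\<exists>c :: 'v \<Rightarrow> nat set. fold_coloring V E b c \<and> colors_used V c = a)"

definition fold_chromatic_number :: "'v set \<Rightarrow> 'v set set \<Rightarrow> nat \<Rightarrow> nat" where
  "fold_chromatic_number V E b = (LEAST a. fold_colorable V E a b)"

text \<open>Real powers on \<open>[0, \<infinity>]\<close>, meant for exponents \<open>r > 0\<close>.\<close>

definition ennpowr :: "ennreal \<Rightarrow> real \<Rightarrow> ennreal" where
  "ennpowr x r = (if x = \<infinity> then \<infinity> else ennreal (enn2real x powr r))"

end

theory Submission
  imports Defs
begin

text \<open>
  Let \<open>C\<close> be the set of the \<open>\<chi>\<close> colors that occur, and for a color \<open>k\<close> let \<open>W k\<close> be the set
  of the vertices whose color set contains \<open>k\<close>. Every vertex lies in exactly \<open>b\<close> of the sets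
  \<open>W k\<close>, so that
  \<open>\<Prod>v\<in>V. \<bar>Y v\<bar> = \<Prod>k\<in>C. Z k\<close> with \<open>Z k = \<Prod>v\<in>W k. \<bar>Y v\<bar> powr (1 / b)\<close>.
  Hoelder's inequality with \<open>\<chi>\<close> equal exponents (\<open>nn_integral_prod_le_Hoelder\<close>) bounds the
  expectation of this product by the product of the \<open>\<chi>\<close>-th roots of the expectations of
  \<open>Z k ^ \<chi> = \<Prod>v\<in>W k. \<bar>Y v\<bar> powr (\<chi> / b)\<close>. No edge joins two vertices of \<open>W k\<close>, hence the
  variables in \<open>W k\<close> are mutually independent (\<open>dependency_graph_indep_vars\<close>) and the expectation
  of \<open>Z k ^ \<chi>\<close> is the product of the moments of order \<open>\<chi> / b\<close>. In the resulting double product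
  every vertex occurs \<open>b\<close> times with exponent \<open>1 / \<chi>\<close>, which gives the exponent \<open>b / \<chi>\<close>.

  The argument is carried out for \<open>\<bar>Y v\<bar>\<close> and with values in \<open>[0, \<infinity>]\<close>
  (\<open>nn_integral_prod_abs_le\<close>), so that it covers infinite moments; nonnegative and integrable
  variables are both special cases. If \<open>\<chi> = b\<close>, all vertices have the same color set, the whole
  family is independent, and the expectation of the product is even equal to the product of the
  expectations, without absolute values.
\<close>

section \<open>Powers of extended nonnegative reals\<close>

lemma ennpowr_ennreal: "0 \<le> x \<Longrightarrow> ennpowr (ennreal x) r = ennreal (x powr r)"
  by (simp add: ennpowr_def)

lemma ennpowr_top [simp]: "ennpowr top r = top"
  by (simp add: ennpowr_def)

lemma ennpowr_eq_0_iff [simp]: "ennpowr x r = 0 \<longleftrightarrow> x = 0"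
  by (cases x) (auto simp: ennpowr_ennreal)

text \<open>
  If one factor is \<open>\<infinity>\<close> and the other is \<open>0\<close>, both sides are \<open>0\<close>, because \<open>0 powr r = 0\<close> for every
  exponent \<open>r\<close>.
\<close>

lemma ennpowr_mult: "ennpowr (x * y) r = ennpowr x r * ennpowr y r"
proof (cases "x = top \<or> y = top")
  case True
  then show ?thesis
    by (cases "x = 0 \<or> y = 0") (auto simp: ennpowr_ennreal ennreal_top_mult ennreal_mult_top)
next
  case False
  then obtain a b where "x = ennreal a" "0 \<le> a" "y = ennreal b" "0 \<le> b"
    by (metis ennreal_cases top_neq_ennreal)
  then show ?thesis
    by (simp add: ennreal_mult[symmetric] ennpowr_ennreal powr_mult)
qed

lemma ennpowr_prod: "ennpowr (\<Prod>i\<in>I. f i) r = (\<Prod>i\<in>I. ennpowr (f i) r)"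
proof (induction I rule: infinite_finite_induct)
  case (insert i I)
  then show ?case by (simp add: ennpowr_mult)
qed (simp_all flip: ennreal_1 add: ennpowr_ennreal)

text \<open>Only for \<open>n > 0\<close>: at \<open>x = 0\<close> the left side would be \<open>0 ^ 0 = 1\<close>, the right side \<open>0\<close>.\<close>

lemma powr_power_pos: "n > 0 \<Longrightarrow> (x powr r) ^ n = x powr (real n * r)" for x :: real
  by (cases "x = 0") (simp_all add: powr_power)

lemma ennpowr_power: "n > 0 \<Longrightarrow> ennpowr x r ^ n = ennpowr x (real n * r)"
  by (cases x)
     (auto simp: ennpowr_ennreal ennreal_power powr_power_pos top_power_ennreal)

section \<open>Hoelder's inequality for finitely many factors\<close>

text \<open>
  Let \<open>N k\<close> be the integral of \<open>f k ^ n\<close>, where \<open>n = card K\<close>. If all \<open>N k\<close> are positive and finite,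
  then normalizing each factor by the root of \<open>N k\<close> reduces the claim to the pointwise AM-GM
  inequality for the numbers \<open>f k x ^ n / N k\<close>: each of them has integral \<open>1\<close>, and so has their
  mean. If some \<open>N k\<close> is \<open>0\<close>, the integrand on the left vanishes almost everywhere, which agrees
  with the convention \<open>0 * \<infinity> = 0\<close> on the right.
\<close>

lemma nn_integral_prod_le_Hoelder:
  fixes f :: "'k \<Rightarrow> 'w \<Rightarrow> real"
  assumes K: "finite K" "K \<noteq> {}"
    and f_meas [measurable]: "\<And>k. k \<in> K \<Longrightarrow> f k \<in> borel_measurable M"
    and f_nonneg: "\<And>k x. k \<in> K \<Longrightarrow> 0 \<le> f k x"
  shows "(\<integral>\<^sup>+ x. ennreal (\<Prod>k\<in>K. f k x) \<partial>M)
    \<le> (\<Prod>k\<in>K. ennpowr (\<integral>\<^sup>+ x. ennreal (f k x ^ card K) \<partial>M) (1 / real (card K)))"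
proof -
  define n where "n = card K"
  have n: "n > 0"
    using K by (auto simp: n_def card_gt_0_iff)
  define N where "N k = (\<integral>\<^sup>+ x. ennreal (f k x ^ n) \<partial>M)" for k
  consider (zero) k where "k \<in> K" "N k = 0"
    | (infinite) k where "k \<in> K" "N k = top" "\<forall>k\<in>K. N k \<noteq> 0"
    | (finite) "\<forall>k\<in>K. N k \<noteq> 0" "\<forall>k\<in>K. N k \<noteq> top"
    by blast
  then have "(\<integral>\<^sup>+ x. ennreal (\<Prod>k\<in>K. f k x) \<partial>M) \<le> (\<Prod>k\<in>K. ennpowr (N k) (1 / real n))"
  proof cases
    case zero
    have "AE x in M. ennreal (f k x ^ n) = 0"
      using zero unfolding N_def by (subst (asm) nn_integral_0_iff_AE) auto
    then have "AE x in M. ennreal (\<Prod>k\<in>K. f k x) = 0"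
    proof eventually_elim
      case (elim x)
      then have "f k x = 0"
        using f_nonneg[OF zero(1), of x] n
        by (metis ennreal_eq_0_iff order_antisym power_eq_0_iff zero_le_power)
      then show ?case
        using zero(1) K(1) by (subst prod_zero) auto
    qed
    then have "(\<integral>\<^sup>+ x. ennreal (\<Prod>k\<in>K. f k x) \<partial>M) = (\<integral>\<^sup>+ x. 0 \<partial>M)"
      by (rule nn_integral_cong_AE)
    then show ?thesis
      by simp
  next
    case infinite
    then have "(\<Prod>k\<in>K. ennpowr (N k) (1 / real n)) = top"
      using K(1) by (subst ennreal_prod_eq_top) (auto intro!: bexI[of _ k])
    then show ?thesis
      by simp
  next
    case finite
    define a where "a k = enn2real (N k)" for k
    have a: "N k = ennreal (a k)" "a k > 0" if "k \<in> K" for k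
      using finite that by (auto simp: a_def enn2real_positive_iff less_top zero_less_iff_neq_zero)
    \<comment> \<open>the real value of the right-hand side, which takes up the normalization of the factors\<close>
    define A where "A = (\<Prod>k\<in>K. a k powr (1 / real n))"
    have A: "A \<ge> 0"
      unfolding A_def by (intro prod_nonneg) auto
    have AM_GM: "(\<Prod>k\<in>K. f k x) \<le> A * (\<Sum>k\<in>K. inverse (real n * a k) * f k x ^ n)" for x
    proof -
      have "(\<Prod>k\<in>K. f k x ^ n / a k) powr (1 / real n) \<le> (\<Sum>k\<in>K. (f k x ^ n / a k) / real n)"
        unfolding n_def using K f_nonneg a
        by (intro arith_geom_mean) (auto intro!: divide_nonneg_pos simp: n_def)
      also have "(\<Prod>k\<in>K. f k x ^ n / a k) powr (1 / real n)
          = (\<Prod>k\<in>K. f k x / a k powr (1 / real n))"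
      proof -
        have "(f k x ^ n / a k) powr (1 / real n) = f k x / a k powr (1 / real n)"
          if "k \<in> K" for k
          using f_nonneg[OF that, of x] a(2)[OF that] n
          by (cases "f k x = 0")
             (auto simp: powr_divide powr_realpow[symmetric] powr_powr)
        moreover have "(\<Prod>k\<in>K. f k x ^ n / a k) powr (1 / real n)
            = (\<Prod>k\<in>K. (f k x ^ n / a k) powr (1 / real n))"
          by (rule prod_powr_distrib)
        ultimately show ?thesis
          by (metis (no_types, lifting) prod.cong)
      qed
      finally have "A * (\<Prod>k\<in>K. f k x / a k powr (1 / real n))
          \<le> A * (\<Sum>k\<in>K. (f k x ^ n / a k) / real n)"
        using A by (rule mult_left_mono)
      moreover have "A * (\<Prod>k\<in>K. f k x / a k powr (1 / real n)) = (\<Prod>k\<in>K. f k x)"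
        unfolding A_def prod.distrib[symmetric] using a(2) by (intro prod.cong) fastforce+
      ultimately show ?thesis
        by (simp add: field_simps)
    qed
    have "(\<integral>\<^sup>+ x. ennreal (\<Prod>k\<in>K. f k x) \<partial>M)
        \<le> (\<integral>\<^sup>+ x. ennreal A * (\<Sum>k\<in>K. ennreal (inverse (real n * a k)) * ennreal (f k x ^ n)) \<partial>M)"
    proof (intro nn_integral_mono)
      fix x
      have "ennreal A * (\<Sum>k\<in>K. ennreal (inverse (real n * a k)) * ennreal (f k x ^ n))
          = ennreal (A * (\<Sum>k\<in>K. inverse (real n * a k) * f k x ^ n))"
        using A a(2) f_nonneg
        by (subst ennreal_mult')
           (auto simp: less_imp_le ennreal_mult' sum_nonneg simp flip: sum_ennreal
             intro!: arg_cong2[where f = "(*)"] sum.cong)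
      then show "ennreal (\<Prod>k\<in>K. f k x)
          \<le> ennreal A * (\<Sum>k\<in>K. ennreal (inverse (real n * a k)) * ennreal (f k x ^ n))"
        using AM_GM[of x] by (simp add: ennreal_leI)
    qed
    also have "\<dots> = ennreal A * (\<Sum>k\<in>K. ennreal (inverse (real n * a k)) * N k)"
      unfolding N_def by (simp add: nn_integral_cmult nn_integral_sum)
    also have "(\<Sum>k\<in>K. ennreal (inverse (real n * a k)) * N k) = (\<Sum>k\<in>K. ennreal (1 / real n))"
    proof (intro sum.cong refl)
      fix k assume "k \<in> K"
      with a[of k] n show "ennreal (inverse (real n * a k)) * N k = ennreal (1 / real n)"
        by (simp add: ennreal_mult'[symmetric] field_simps)
    qed
    also have "\<dots> = ennreal (\<Sum>k\<in>K. 1 / real n)"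
      by (intro sum_ennreal) auto
    also have "\<dots> = 1"
      using n by (simp add: n_def)
    also have "ennreal A * 1 = (\<Prod>k\<in>K. ennpowr (N k) (1 / real n))"
      unfolding A_def using a
      by (auto simp: ennpowr_ennreal less_imp_le simp flip: prod_ennreal intro!: prod.cong)
    finally show ?thesis .
  qed
  then show ?thesis
    by (simp add: N_def n_def)
qed

section \<open>Independence inside a color class\<close>

text \<open>
  A dependency graph only says that one variable is independent of a vector of others. Adding the
  vertices of a stable set one at a time, each is independent of the vector of those added before,
  so the product rule for the probabilities of the events \<open>Y v \<in> B v\<close> follows by induction.
\<close>

lemma dependency_graph_indep_vars:
  fixes M :: "'w measure" and Y :: "'v \<Rightarrow> 'w \<Rightarrow> real"
  assumes "prob_space M" and dep: "dependency_graph M Y V E"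
    and S: "S \<subseteq> V" and stable: "\<And>u v. u \<in> S \<Longrightarrow> v \<in> S \<Longrightarrow> {u, v} \<notin> E"
  shows "prob_space.indep_vars M (\<lambda>_. borel) Y S"
proof -
  interpret prob_space M by fact
  have rv: "Y v \<in> borel_measurable M" if "v \<in> S" for v
    using dep S that by (auto simp: dependency_graph_def)
  have product_rule: "prob (\<Inter>v\<in>J. Y v -` B v \<inter> space M) = (\<Prod>v\<in>J. prob (Y v -` B v \<inter> space M))"
    if "finite J" "J \<noteq> {}" "J \<subseteq> S" "\<And>v. v \<in> J \<Longrightarrow> B v \<in> sets borel" for J and B :: "'v \<Rightarrow> real set"
    using that
  proof (induction J rule: finite_ne_induct)
    case (singleton v)
    then show ?case by simp
  next
    case (insert v J)
    have indep: "indep_var (\<Pi>\<^sub>M u\<in>{v}. borel) (\<lambda>\<omega>. \<lambda>u\<in>{v}. Y u \<omega>)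
        (\<Pi>\<^sub>M u\<in>J. borel) (\<lambda>\<omega>. \<lambda>u\<in>J. Y u \<omega>)"
    proof -
      have "J \<subseteq> V" "v \<in> V - J" "\<forall>u\<in>J. {v, u} \<notin> E"
        using insert S stable by auto
      then show ?thesis
        using dep unfolding dependency_graph_def by blast
    qed
    have "prob ((\<lambda>\<omega>. (\<lambda>u\<in>{v}. Y u \<omega>, \<lambda>u\<in>J. Y u \<omega>)) -` (PiE {v} B \<times> PiE J B) \<inter> space M)
        = prob ((\<lambda>\<omega>. \<lambda>u\<in>{v}. Y u \<omega>) -` PiE {v} B \<inter> space M)
        * prob ((\<lambda>\<omega>. \<lambda>u\<in>J. Y u \<omega>) -` PiE J B \<inter> space M)"
      using insert by (intro indep_varD[OF indep] sets_PiM_I_finite) auto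
    moreover have "(\<lambda>\<omega>. (\<lambda>u\<in>{v}. Y u \<omega>, \<lambda>u\<in>J. Y u \<omega>)) -` (PiE {v} B \<times> PiE J B) \<inter> space M
        = (\<Inter>u\<in>insert v J. Y u -` B u \<inter> space M)"
      using insert.hyps by (auto simp: PiE_iff)
    moreover have "(\<lambda>\<omega>. \<lambda>u\<in>{v}. Y u \<omega>) -` PiE {v} B \<inter> space M = Y v -` B v \<inter> space M"
      by (auto simp: PiE_iff)
    moreover have "(\<lambda>\<omega>. \<lambda>u\<in>J. Y u \<omega>) -` PiE J B \<inter> space M = (\<Inter>u\<in>J. Y u -` B u \<inter> space M)"
      using insert.hyps by (auto simp: PiE_iff)
    ultimately show ?case
      using insert by simp
  qed
  show ?thesis
    unfolding indep_vars_def2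
  proof (intro conjI ballI indep_setsI)
    fix A J
    assume J: "J \<noteq> {}" "J \<subseteq> S" "finite J"
      and "\<forall>v\<in>J. A v \<in> {Y v -` B \<inter> space M |B. B \<in> sets borel}"
    then obtain B where B: "\<And>v. v \<in> J \<Longrightarrow> A v = Y v -` B v \<inter> space M \<and> B v \<in> sets borel"
      by (simp, metis)
    then show "prob (\<Inter>v\<in>J. A v) = (\<Prod>v\<in>J. prob (A v))"
      using product_rule[of J B] J by simp
  qed (use rv in \<open>auto intro: measurable_sets\<close>)
qed

section \<open>The bound for absolute values\<close>

lemma color_class_stable:
  assumes "finite_loopless_graph V E" "fold_coloring V E b c"
    and "u \<in> V" "v \<in> V" "k \<in> c u" "k \<in> c v"
  shows "{u, v} \<notin> E"
  using assms unfolding fold_coloring_def by blast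

text \<open>
  Hoelder's inequality over the colors, then independence inside each color class. It needs at
  least one color, so the empty vertex set, where both sides are \<open>1\<close>, is treated apart.
\<close>

lemma nn_integral_prod_abs_le:
  fixes M :: "'w measure"
    and V :: "'v set" and E :: "'v set set" and c :: "'v \<Rightarrow> 'c set"
  assumes "prob_space M" and dep: "dependency_graph M Y V E"
    and "b > 0" and col: "fold_coloring V E b c" and chi: "colors_used V c = chi"
  shows "(\<integral>\<^sup>+ \<omega>. ennreal (\<Prod>v\<in>V. \<bar>Y v \<omega>\<bar>) \<partial>M)
    \<le> (\<Prod>v\<in>V. ennpowr (\<integral>\<^sup>+ \<omega>. ennreal (\<bar>Y v \<omega>\<bar> powr (real chi / real b)) \<partial>M)
                       (real b / real chi))"
proof (cases "V = {}")
  case True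
  interpret prob_space M by fact
  show ?thesis
    using True by (simp add: emeasure_space_1)
next
  case False
  interpret prob_space M by fact
  have graph: "finite_loopless_graph V E" and "finite V"
    and Y_meas: "\<And>v. v \<in> V \<Longrightarrow> Y v \<in> borel_measurable M"
    using dep by (auto simp: dependency_graph_def finite_loopless_graph_def)
  have c: "finite (c v)" "card (c v) = b" if "v \<in> V" for v
    using col that by (auto simp: fold_coloring_def)
  define C where "C = (\<Union>v\<in>V. c v)"
  have "finite C"
    using \<open>finite V\<close> c by (auto simp: C_def)
  have card_C: "card C = chi"
    using chi by (simp add: C_def colors_used_def)
  have "C \<noteq> {}"
    using False c \<open>b > 0\<close> by (fastforce simp: C_def)
  then have "chi > 0"
    using \<open>finite C\<close> card_C by (auto simp: card_gt_0_iff)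
  define W where "W k = {v \<in> V. k \<in> c v}" for k
  \<comment> \<open>double counting of the pairs of a vertex and one of its \<open>b\<close> colors; used for real factors
    before the integration and for factors in \<open>[0, \<infinity>]\<close> after it\<close>
  have regroup: "(\<Prod>k\<in>C. \<Prod>v\<in>W k. g v) = (\<Prod>v\<in>V. g v ^ b)"
    for g :: "'v \<Rightarrow> 'r::comm_semiring_1"
  proof -
    have "(\<Prod>k\<in>C. \<Prod>v\<in>W k. g v) = (\<Prod>v\<in>V. \<Prod>k\<in>{k \<in> C. k \<in> c v}. g v)"
      unfolding W_def using \<open>finite C\<close> \<open>finite V\<close> by (rule prod.swap_restrict)
    also have "\<dots> = (\<Prod>v\<in>V. g v ^ b)"
    proof (intro prod.cong refl)
      fix v assume "v \<in> V"
      then have "{k \<in> C. k \<in> c v} = c v"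
        by (auto simp: C_def)
      with c(2)[OF \<open>v \<in> V\<close>] show "(\<Prod>k\<in>{k \<in> C. k \<in> c v}. g v) = g v ^ b"
        by simp
    qed
    finally show ?thesis .
  qed
  define m where "m v = (\<integral>\<^sup>+ \<omega>. ennreal (\<bar>Y v \<omega>\<bar> powr (real chi / real b)) \<partial>M)" for v
  have class_moment: "(\<integral>\<^sup>+ \<omega>. ennreal ((\<Prod>v\<in>W k. \<bar>Y v \<omega>\<bar> powr (1 / real b)) ^ chi) \<partial>M)
      = (\<Prod>v\<in>W k. m v)" for k
  proof -
    have "indep_vars (\<lambda>_. borel) Y (W k)"
      using color_class_stable[OF graph col]
      by (intro dependency_graph_indep_vars[OF \<open>prob_space M\<close> dep]) (auto simp: W_def)
    then have indep: "indep_vars (\<lambda>_. borel)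
        (\<lambda>v \<omega>. ennreal (\<bar>Y v \<omega>\<bar> powr (real chi / real b))) (W k)"
      by (rule indep_vars_compose2[where Y = "\<lambda>_ y. ennreal (\<bar>y\<bar> powr (real chi / real b))"])
         measurable
    have "ennreal ((\<Prod>v\<in>W k. \<bar>Y v \<omega>\<bar> powr (1 / real b)) ^ chi)
        = (\<Prod>v\<in>W k. ennreal (\<bar>Y v \<omega>\<bar> powr (real chi / real b)))" for \<omega>
      using \<open>chi > 0\<close> by (simp add: prod_ennreal powr_power_pos prod_power_distrib)
    then show ?thesis
      unfolding m_def using \<open>finite V\<close> indep
      by (simp add: indep_vars_nn_integral W_def)
  qed
  have "(\<integral>\<^sup>+ \<omega>. ennreal (\<Prod>v\<in>V. \<bar>Y v \<omega>\<bar>) \<partial>M)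
      = (\<integral>\<^sup>+ \<omega>. ennreal (\<Prod>k\<in>C. \<Prod>v\<in>W k. \<bar>Y v \<omega>\<bar> powr (1 / real b)) \<partial>M)"
    using \<open>b > 0\<close> by (simp add: regroup powr_power_pos)
  also have "\<dots> \<le> (\<Prod>k\<in>C. ennpowr (\<integral>\<^sup>+ \<omega>. ennreal ((\<Prod>v\<in>W k. \<bar>Y v \<omega>\<bar> powr (1 / real b)) ^ chi) \<partial>M)
      (1 / real chi))"
    unfolding card_C[symmetric] using \<open>finite C\<close> \<open>C \<noteq> {}\<close> Y_meas
    by (intro nn_integral_prod_le_Hoelder) (auto intro!: prod_nonneg borel_measurable_prod simp: W_def)
  also have "\<dots> = (\<Prod>k\<in>C. \<Prod>v\<in>W k. ennpowr (m v) (1 / real chi))"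
    by (simp add: class_moment ennpowr_prod)
  also have "\<dots> = (\<Prod>v\<in>V. ennpowr (m v) (real b / real chi))"
    using \<open>b > 0\<close> by (simp add: regroup ennpowr_power)
  finally show ?thesis
    by (simp add: m_def)
qed

text \<open>
  If only \<open>b\<close> colors occur, every color set, having \<open>b\<close> elements, consists of all of them. So any
  two vertices share a color, there are no edges, and the whole family is independent.
\<close>

lemma integral_prod_eq_if_colors_used_eq_fold:
  fixes M :: "'w measure"
    and V :: "'v set" and E :: "'v set set" and c :: "'v \<Rightarrow> 'c set"
  assumes "prob_space M" and dep: "dependency_graph M Y V E"
    and "b > 0" and col: "fold_coloring V E b c" and b: "colors_used V c = b"
    and int: "\<And>v. v \<in> V \<Longrightarrow> integrable M (Y v)"
  shows "(\<integral>\<omega>. (\<Prod>v\<in>V. Y v \<omega>) \<partial>M) = (\<Prod>v\<in>V. \<integral>\<omega>. Y v \<omega> \<partial>M)"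
proof -
  interpret prob_space M by fact
  have graph: "finite_loopless_graph V E" and "finite V"
    using dep by (auto simp: dependency_graph_def finite_loopless_graph_def)
  have c: "finite (c v)" "card (c v) = b" if "v \<in> V" for v
    using col that by (auto simp: fold_coloring_def)
  have same: "c v = (\<Union>u\<in>V. c u)" if "v \<in> V" for v
    using that c \<open>finite V\<close> b by (intro card_subset_eq) (auto simp: colors_used_def)
  have "{u, v} \<notin> E" if "u \<in> V" "v \<in> V" for u v
  proof -
    have "c u \<noteq> {}"
      using c[OF that(1)] \<open>b > 0\<close> by auto
    then obtain k where "k \<in> c u" by blast
    moreover from this have "k \<in> c v"
      using same that by metis
    ultimately show ?thesis
      using color_class_stable[OF graph col that] by blast
  qed
  then have "indep_vars (\<lambda>_. borel) Y V"
    by (intro dependency_graph_indep_vars[OF \<open>prob_space M\<close> dep]) auto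
  then show ?thesis
    using \<open>finite V\<close> int by (intro indep_vars_lebesgue_integral)
qed

theorem theorem2p2:
  fixes M :: "'w measure"
    and V :: "'v set" and E :: "'v set set"
    and Y :: "'v \<Rightarrow> 'w \<Rightarrow> real"
    and b chi :: nat and c :: "'v \<Rightarrow> 'c set"
  assumes "prob_space M"
    and "dependency_graph M Y V E"
    and "b > 0"
    and "chi = fold_chromatic_number V E b"
    and "fold_coloring V E b c"
    and "colors_used V c = chi"
  shows
    "((\<forall>v\<in>V. AE \<omega> in M. 0 \<le> Y v \<omega>) \<longrightarrow>
        (\<integral>\<^sup>+ \<omega>. ennreal (\<Prod>v\<in>V. Y v \<omega>) \<partial>M)
          \<le> (\<Prod>v\<in>V. ennpowr (\<integral>\<^sup>+ \<omega>. ennreal (Y v \<omega> powr (real chi / real b)) \<partial>M)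
                             (real b / real chi)))
     \<and> ((\<forall>v\<in>V. integrable M (\<lambda>\<omega>. \<bar>Y v \<omega>\<bar> powr (real chi / real b))) \<longrightarrow>
        integrable M (\<lambda>\<omega>. \<Prod>v\<in>V. Y v \<omega>) \<and>
        (\<integral>\<omega>. (\<Prod>v\<in>V. Y v \<omega>) \<partial>M)
          \<le> (\<Prod>v\<in>V. (\<integral>\<omega>. \<bar>Y v \<omega>\<bar> powr (real chi / real b) \<partial>M) powr (real b / real chi)) \<and>
        (chi = b \<longrightarrow>
          (\<integral>\<omega>. (\<Prod>v\<in>V. Y v \<omega>) \<partial>M) \<le> (\<Prod>v\<in>V. (\<integral>\<omega>. Y v \<omega> \<partial>M))))"
proof (rule conjI; intro impI)
  define p where "p = real chi / real b"
  define q where "q = real b / real chi"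
  have "finite V" and Y_meas [measurable]: "\<And>v. v \<in> V \<Longrightarrow> Y v \<in> borel_measurable M"
    using assms(2) by (auto simp: dependency_graph_def finite_loopless_graph_def)
  have bound: "(\<integral>\<^sup>+ \<omega>. ennreal (\<Prod>v\<in>V. \<bar>Y v \<omega>\<bar>) \<partial>M)
      \<le> (\<Prod>v\<in>V. ennpowr (\<integral>\<^sup>+ \<omega>. ennreal (\<bar>Y v \<omega>\<bar> powr p) \<partial>M) q)"
    unfolding p_def q_def using assms by (intro nn_integral_prod_abs_le)
  show "(\<integral>\<^sup>+ \<omega>. ennreal (\<Prod>v\<in>V. Y v \<omega>) \<partial>M)
      \<le> (\<Prod>v\<in>V. ennpowr (\<integral>\<^sup>+ \<omega>. ennreal (Y v \<omega> powr (real chi / real b)) \<partial>M)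
                         (real b / real chi))"
    if nonneg: "\<forall>v\<in>V. AE \<omega> in M. 0 \<le> Y v \<omega>"
  proof -
    have "(\<integral>\<^sup>+ \<omega>. ennreal (\<Prod>v\<in>V. Y v \<omega>) \<partial>M) \<le> (\<integral>\<^sup>+ \<omega>. ennreal (\<Prod>v\<in>V. \<bar>Y v \<omega>\<bar>) \<partial>M)"
      by (intro nn_integral_mono ennreal_leI) (simp flip: abs_prod)
    moreover have "(\<integral>\<^sup>+ \<omega>. ennreal (\<bar>Y v \<omega>\<bar> powr p) \<partial>M) = (\<integral>\<^sup>+ \<omega>. ennreal (Y v \<omega> powr p) \<partial>M)"
      if "v \<in> V" for v
    proof (rule nn_integral_cong_AE)
      show "AE \<omega> in M. ennreal (\<bar>Y v \<omega>\<bar> powr p) = ennreal (Y v \<omega> powr p)"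
        using bspec[OF nonneg that] by eventually_elim simp
    qed
    ultimately show ?thesis
      using bound by (auto simp: p_def q_def cong: prod.cong)
  qed
  assume "\<forall>v\<in>V. integrable M (\<lambda>\<omega>. \<bar>Y v \<omega>\<bar> powr (real chi / real b))"
  then have int: "integrable M (\<lambda>\<omega>. \<bar>Y v \<omega>\<bar> powr p)" if "v \<in> V" for v
    using that by (simp add: p_def)
  define R where "R = (\<Prod>v\<in>V. (\<integral>\<omega>. \<bar>Y v \<omega>\<bar> powr p \<partial>M) powr q)"
  have "R \<ge> 0"
    unfolding R_def by (intro prod_nonneg) auto
  have "(\<Prod>v\<in>V. ennpowr (\<integral>\<^sup>+ \<omega>. ennreal (\<bar>Y v \<omega>\<bar> powr p) \<partial>M) q) = ennreal R"
    unfolding R_def using int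
    by (auto simp: nn_integral_eq_integral ennpowr_ennreal simp flip: prod_ennreal intro!: prod.cong)
  with bound have norm_le: "(\<integral>\<^sup>+ \<omega>. ennreal (norm (\<Prod>v\<in>V. Y v \<omega>)) \<partial>M) \<le> ennreal R"
    by (simp add: abs_prod)
  have prod_meas: "(\<lambda>\<omega>. \<Prod>v\<in>V. Y v \<omega>) \<in> borel_measurable M"
    by measurable
  have prod_int: "integrable M (\<lambda>\<omega>. \<Prod>v\<in>V. Y v \<omega>)"
    using norm_le prod_meas by (intro integrableI_bounded) (auto intro: le_less_trans)
  have "ennreal (\<integral>\<omega>. norm (\<Prod>v\<in>V. Y v \<omega>) \<partial>M) \<le> ennreal R"
    using norm_le prod_int by (subst nn_integral_eq_integral[symmetric]) auto
  then have "(\<integral>\<omega>. (\<Prod>v\<in>V. Y v \<omega>) \<partial>M) \<le> R"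
    using integral_norm_bound[of M "\<lambda>\<omega>. \<Prod>v\<in>V. Y v \<omega>"] \<open>R \<ge> 0\<close> by (simp add: abs_le_iff)
  moreover have "(\<integral>\<omega>. (\<Prod>v\<in>V. Y v \<omega>) \<partial>M) \<le> (\<Prod>v\<in>V. \<integral>\<omega>. Y v \<omega> \<partial>M)" if "chi = b"
  proof -
    have "integrable M (Y v)" if "v \<in> V" for v
      using int[OF that] Y_meas[OF that] \<open>chi = b\<close> \<open>b > 0\<close>
      by (simp add: p_def integrable_abs_iff)
    then show ?thesis
      using assms \<open>chi = b\<close>
      by (intro eq_refl integral_prod_eq_if_colors_used_eq_fold) auto
  qed
  ultimately show "integrable M (\<lambda>\<omega>. \<Prod>v\<in>V. Y v \<omega>) \<and>
        (\<integral>\<omega>. (\<Prod>v\<in>V. Y v \<omega>) \<partial>M)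
          \<le> (\<Prod>v\<in>V. (\<integral>\<omega>. \<bar>Y v \<omega>\<bar> powr (real chi / real b) \<partial>M) powr (real b / real chi)) \<and>
        (chi = b \<longrightarrow>
          (\<integral>\<omega>. (\<Prod>v\<in>V. Y v \<omega>) \<partial>M) \<le> (\<Prod>v\<in>V. (\<integral>\<omega>. Y v \<omega> \<partial>M)))"
    using prod_int by (simp add: R_def p_def q_def)
qed

end
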